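(* Let $\Lambda\subset\mathbb{N}_0^d$ be a finite (nonempty) lower set. Then $$\#\mathcal{M}(\Lambda)=\sum_{\mathbf{k}\in\Lambda}2^{|\mathbf{k}|_0}\ \le\ \#(\Lambda\oplus\Lambda),$$ where equality holds in the inequality if and only if $\Lambda=\mathcal{B}_{\mathbf{k}}$ for some $\mathbf{k}\in\mathbb{N}_0^d$.
   Context: A set $\Lambda\subset\mathbb{N}_0^d$ is lower if $\mathbf{k}\in\Lambda$ and $\mathbf{h}\in\mathbb{N}_0^d$ with $\mathbf{h}\le\mathbf{k}$ (component-wise) imply $\mathbf{h}\in\Lambda$. $|\mathbf{k}|_0$ is the number of nonzero coordinates of $\mathbf{k}$. The mirrored set $\mathcal{M}(\Lambda)\subset\mathbb{Z}^d$ is the set of all vectors obtained from elements of $\Lambda$ by arbitrary component-wise sign changes. $\Lambda\oplus\Lambda'=\{\mathbf{h}+\mathbf{k}:\mathbf{h}\in\Lambda,\mathbf{k}\in\Lambda'\}$. $\mathcal{B}_{\mathbf{k}}=\{\mathbf{h}\in\mathbb{N}_0^d:\mathbf{h}\le\mathbf{k}\}$. $\#$ denotes cardinality. *)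

theory Defs
  imports "HOL-Analysis.Analysis"
begin

text \<open>
  Multi-indices are vectors of type \<open>nat ^ 'd\<close>, ordered component-wise by the library order
  (hence \<open>{..k}\<close> is the box of all multi-indices below \<open>k\<close>), and \<open>+\<close> on sets is
  the Minkowski sum from \<open>HOL-Library.Set_Algebras\<close>.
\<close>

definition lower :: "(nat ^ 'd) set \<Rightarrow> bool" where
  "lower \<Lambda> \<longleftrightarrow> (\<forall>k\<in>\<Lambda>. \<forall>h. h \<le> k \<longrightarrow> h \<in> \<Lambda>)"

definition zero_norm :: "nat ^ 'd \<Rightarrow> nat" where
  "zero_norm k = card {i. k $ i \<noteq> 0}"

definition mirror :: "(nat ^ 'd) set \<Rightarrow> (int ^ 'd) set" where
  "mirror \<Lambda> = {(\<chi> i. s i * int (k $ i)) | s k. k \<in> \<Lambda> \<and> (\<forall>i. s i \<in> {-1, 1})}"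

end

theory Submission
  imports Defs
begin

text \<open>
  Put \<open>D = {t. \<lceil>t/2\<rceil> \<in> \<Lambda>}\<close>, with the ceiling taken component-wise. The fibre of
  \<open>t \<mapsto> \<lceil>t/2\<rceil>\<close> over \<open>k\<close> has \<open>2 ^ zero_norm k\<close> elements, like the fibre of the mirrored set,
  and \<open>D \<subseteq> \<Lambda> + \<Lambda>\<close> because \<open>t = \<lceil>t/2\<rceil> + \<lfloor>t/2\<rfloor>\<close> and \<open>\<Lambda>\<close> is lower.
  Equality of the cardinalities thus means that \<open>\<Lambda>\<close> is closed under \<open>(a, b) \<mapsto> \<lceil>(a + b)/2\<rceil>\<close>.
  Let \<open>k \<in> \<Lambda>\<close> have maximal coordinate sum. If some \<open>b \<in> \<Lambda>\<close> exceeded \<open>k\<close> in coordinate \<open>i\<close>,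
  then iterating \<open>b \<mapsto> \<lceil>(k + b)/2\<rceil>\<close> would keep this excess and finally lift all other coordinates
  to at least those of \<open>k\<close>, contradicting maximality. So \<open>\<Lambda>\<close> is the box below \<open>k\<close>.
\<close>

definition ceil_half :: "nat ^ 'd \<Rightarrow> nat ^ 'd" where
  "ceil_half t = (\<chi> i. (t $ i + 1) div 2)"

lemma ceil_half_nth [simp]: "ceil_half t $ i = (t $ i + 1) div 2"
  by (simp add: ceil_half_def)

lemma lowerD: "lower \<Lambda> \<Longrightarrow> k \<in> \<Lambda> \<Longrightarrow> h \<le> k \<Longrightarrow> h \<in> \<Lambda>"
  by (auto simp: lower_def)

text \<open>Shared count for both fibrations over \<open>\<Lambda>\<close>: a fibre over
  \<open>k\<close> is parametrised by the subsets \<open>S\<close> of the support of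
  \<open>k\<close>.\<close>

lemma card_image_support_subsets:
  fixes \<Lambda> :: "(nat ^ 'd) set"
  assumes "finite \<Lambda>"
    and "inj_on (\<lambda>(k, S). f k S) (SIGMA k:\<Lambda>. Pow {i. k $ i \<noteq> 0})"
  shows "card ((\<lambda>(k, S). f k S) ` (SIGMA k:\<Lambda>. Pow {i. k $ i \<noteq> 0})) = (\<Sum>k\<in>\<Lambda>. 2 ^ zero_norm k)"
  using assms by (simp add: card_image card_SigmaI card_Pow zero_norm_def)

lemma card_mirror:
  fixes \<Lambda> :: "(nat ^ 'd) set"
  assumes "finite \<Lambda>"
  shows "card (mirror \<Lambda>) = (\<Sum>k\<in>\<Lambda>. 2 ^ zero_norm k)"
proof -
  \<comment> \<open>\<open>S\<close> collects the coordinates whose sign is flipped; keeping it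
    inside the support makes it unique, since flipping a zero changes nothing.\<close>
  define f :: "nat ^ 'd \<Rightarrow> 'd set \<Rightarrow> int ^ 'd"
    where "f k S = (\<chi> i. (if i \<in> S then - 1 else 1) * int (k $ i))" for k S
  let ?P = "SIGMA k:\<Lambda>. Pow {i. k $ i \<noteq> 0}"
  have "inj_on (\<lambda>(k, S). f k S) ?P"
  proof (rule inj_onI, clarsimp)
    fix k S l T
    assume S: "S \<subseteq> {i. 0 < k $ i}" and T: "T \<subseteq> {i. 0 < l $ i}" and eq: "f k S = f l T"
    have c: "(if i \<in> S then - 1 else 1) * int (k $ i) = (if i \<in> T then - 1 else 1) * int (l $ i)" for i
      using eq by (simp add: f_def vec_eq_iff)
    have "k $ i = l $ i" for i
      using c[of i] by (auto split: if_splits)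
    moreover have "i \<in> S \<longleftrightarrow> i \<in> T" for i
      using c[of i] S T by (auto split: if_splits)
    ultimately show "k = l \<and> S = T"
      by (auto simp: vec_eq_iff)
  qed
  moreover have "mirror \<Lambda> = (\<lambda>(k, S). f k S) ` ?P"
  proof (intro equalityI subsetI)
    fix x assume "x \<in> mirror \<Lambda>"
    then obtain s k where k: "k \<in> \<Lambda>" and s: "\<And>i. s i \<in> {-1, 1}"
      and x: "x = (\<chi> i. s i * int (k $ i))"
      by (auto simp: mirror_def)
    let ?S = "{i. k $ i \<noteq> 0 \<and> s i = -1}"
    have "x = f k ?S"
      using s by (fastforce simp: x f_def vec_eq_iff)
    with k show "x \<in> (\<lambda>(k, S). f k S) ` ?P"
      by force
  next
    fix x assume "x \<in> (\<lambda>(k, S). f k S) ` ?P"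
    then obtain k S where "k \<in> \<Lambda>" "x = f k S"
      by auto
    then show "x \<in> mirror \<Lambda>"
      unfolding mirror_def f_def
      by (intro CollectI exI[of _ "\<lambda>i. if i \<in> S then - 1 else 1"] exI[of _ k]) auto
  qed
  ultimately show ?thesis
    using card_image_support_subsets[OF assms] by metis
qed

lemma card_ceil_half_vimage:
  fixes \<Lambda> :: "(nat ^ 'd) set"
  assumes "finite \<Lambda>"
  shows "card (ceil_half -` \<Lambda>) = (\<Sum>k\<in>\<Lambda>. 2 ^ zero_norm k)"
proof -
  \<comment> \<open>The solutions of \<lceil>t/2\<rceil> = m are 2m and, for m > 0, also 2m - 1;
    \<open>S\<close> marks the coordinates where the odd one is taken.\<close>
  define f :: "nat ^ 'd \<Rightarrow> 'd set \<Rightarrow> nat ^ 'd"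
    where "f k S = (\<chi> i. 2 * k $ i - (if i \<in> S then 1 else 0))" for k S
  let ?P = "SIGMA k:\<Lambda>. Pow {i. k $ i \<noteq> 0}"
  have half: "ceil_half (f k S) = k" if "S \<subseteq> {i. k $ i \<noteq> 0}" for k S
    using that by (auto simp: f_def vec_eq_iff)
  have "inj_on (\<lambda>(k, S). f k S) ?P"
  proof (rule inj_onI, clarify)
    fix k S l T
    assume S: "S \<subseteq> {i. k $ i \<noteq> 0}" and T: "T \<subseteq> {i. l $ i \<noteq> 0}" and eq: "f k S = f l T"
    have "k = l"
      using half[OF S] half[OF T] eq by simp
    moreover have "i \<in> S \<longleftrightarrow> i \<in> T" for i
    proof -
      have "f k S $ i = f k T $ i"
        using eq \<open>k = l\<close> by simp
      then show ?thesis
        using S T \<open>k = l\<close> by (auto simp: f_def split: if_splits)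
    qed
    ultimately show "k = l \<and> S = T"
      by auto
  qed
  moreover have "ceil_half -` \<Lambda> = (\<lambda>(k, S). f k S) ` ?P"
  proof (intro equalityI subsetI)
    fix t assume t: "t \<in> ceil_half -` \<Lambda>"
    let ?S = "{i. odd (t $ i)}"
    have "t $ i = f (ceil_half t) ?S $ i" for i
      by (cases "even (t $ i)") (auto simp: f_def elim!: evenE oddE)
    then have "t = f (ceil_half t) ?S"
      by (subst vec_eq_iff) blast
    moreover have "?S \<subseteq> {i. ceil_half t $ i \<noteq> 0}"
      by (auto elim!: oddE)
    ultimately show "t \<in> (\<lambda>(k, S). f k S) ` ?P"
      using t by (intro image_eqI[where x = "(ceil_half t, ?S)"]) auto
  qed (auto simp: half)
  ultimately show ?thesis
    using card_image_support_subsets[OF assms] by metis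
qed

lemma ceil_half_vimage_subset:
  fixes \<Lambda> :: "(nat ^ 'd) set"
  assumes "lower \<Lambda>"
  shows "ceil_half -` \<Lambda> \<subseteq> \<Lambda> + \<Lambda>"
proof
  fix t assume t: "t \<in> ceil_half -` \<Lambda>"
  let ?h = "\<chi> i. t $ i div 2"
  have "?h \<le> ceil_half t"
    by (auto simp: less_eq_vec_def intro!: div_le_mono)
  then have "?h \<in> \<Lambda>"
    using assms t by (auto intro: lowerD)
  moreover have "t = ceil_half t + ?h"
    by (auto simp: vec_eq_iff)
  ultimately show "t \<in> \<Lambda> + \<Lambda>"
    using t by (metis set_plus_intro vimageD)
qed

text \<open>In a box the converse inclusion holds too: two entries bounded by \<open>k $ i\<close>
  have sum at most \<open>2 * k $ i\<close>, whose rounded-up half is again at most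
  \<open>k $ i\<close>.\<close>

lemma ceil_half_vimage_atMost: "ceil_half -` {..k} = {..k} + {..k}"
proof (intro equalityI ceil_half_vimage_subset subsetI)
  show "lower {..k}"
    by (auto simp: lower_def)
  fix t assume "t \<in> {..k} + {..k}"
  then obtain a b where t: "t = a + b" and ab: "\<And>i. a $ i \<le> k $ i" "\<And>i. b $ i \<le> k $ i"
    by (auto simp: set_plus_def less_eq_vec_def)
  have "(a $ i + b $ i + 1) div 2 \<le> k $ i" for i
    using ab[of i] by linarith
  then show "t \<in> ceil_half -` {..k}"
    by (simp add: t less_eq_vec_def)
qed

lemma atMost_if_ceil_half_closed:
  fixes \<Lambda> :: "(nat ^ 'd) set"
  assumes "finite \<Lambda>" "\<Lambda> \<noteq> {}" "lower \<Lambda>"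
    and closed: "\<And>a b. a \<in> \<Lambda> \<Longrightarrow> b \<in> \<Lambda> \<Longrightarrow> ceil_half (a + b) \<in> \<Lambda>"
  shows "\<exists>k. \<Lambda> = {..k}"
proof -
  let ?s = "\<lambda>k :: nat ^ 'd. \<Sum>i\<in>UNIV. k $ i"
  obtain k where k: "k \<in> \<Lambda>" and k_max: "\<And>b. b \<in> \<Lambda> \<Longrightarrow> ?s b \<le> ?s k"
  proof -
    have "Max (?s ` \<Lambda>) \<in> ?s ` \<Lambda>"
      using assms(1,2) by (intro Max_in) auto
    then obtain k where "k \<in> \<Lambda>" "?s k = Max (?s ` \<Lambda>)"
      by auto
    then show thesis
      using assms(1) by (intro that[of k]) auto
  qed
  have no_excess: "\<not> k $ i < b $ i" if "b \<in> \<Lambda>" for b i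
    using that
  \<comment> \<open>The measure is the total deficit of \<open>b\<close> below \<open>k\<close>;
    truncated subtraction ignores coordinates where \<open>b\<close> is larger.\<close>
  proof (induction "\<Sum>j\<in>UNIV. k $ j - b $ j" arbitrary: b rule: less_induct)
    case less
    show ?case
    proof
      assume i: "k $ i < b $ i"
      show False
      proof (cases "\<forall>j. k $ j \<le> b $ j")
        case True
        then have "?s k < ?s b"
          using i by (intro sum_strict_mono_ex1) auto
        then show False
          using k_max[OF less.prems] by simp
      next
        case False
        then obtain j where j: "b $ j < k $ j"
          by (auto simp: not_le)
        let ?c = "ceil_half (k + b)"
        \<comment> \<open>Averaging with \<open>k\<close> creates no new deficit, and rounding up
          strictly raises \<open>b $ j\<close> wherever it lies below \<open>k $ j\<close>.\<close>
        have "(\<Sum>j\<in>UNIV. k $ j - ?c $ j) < (\<Sum>j\<in>UNIV. k $ j - b $ j)"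
        proof (rule sum_strict_mono_ex1)
          show "\<forall>j\<in>UNIV. k $ j - ?c $ j \<le> k $ j - b $ j"
          proof
            fix j show "k $ j - ?c $ j \<le> k $ j - b $ j"
              by (cases "b $ j \<le> k $ j") auto
          qed
          show "\<exists>j\<in>UNIV. k $ j - ?c $ j < k $ j - b $ j"
            using j by (intro bexI[of _ j]) auto
        qed simp
        \<comment> \<open>Rounding up matters here: an excess of 1 would be lost when rounding
          down.\<close>
        moreover have "k $ i < ?c $ i"
          using i by simp
        ultimately show False
          using less.hyps[of ?c] closed[OF k less.prems] by blast
      qed
    qed
  qed
  have "\<Lambda> = {..k}"
    using no_excess lowerD[OF assms(3) k] by (auto simp: less_eq_vec_def not_less)
  then show ?thesis ..
qed

theorem propositionA2:
  fixes \<Lambda> :: "(nat ^ 'd) set"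
  assumes "finite \<Lambda>" and "\<Lambda> \<noteq> {}" and "lower \<Lambda>"
  shows "card (mirror \<Lambda>) = (\<Sum>k\<in>\<Lambda>. 2 ^ zero_norm k)
    \<and> (\<Sum>k\<in>\<Lambda>. 2 ^ zero_norm k) \<le> card (\<Lambda> + \<Lambda>)
    \<and> ((\<Sum>k\<in>\<Lambda>. 2 ^ zero_norm k) = card (\<Lambda> + \<Lambda>) \<longleftrightarrow> (\<exists>k. \<Lambda> = {..k}))"
proof -
  have fin: "finite (\<Lambda> + \<Lambda>)"
    using assms(1) by (simp add: finite_set_plus)
  note sub = ceil_half_vimage_subset[OF assms(3)]
  have "\<exists>k. \<Lambda> = {..k}" if "card (ceil_half -` \<Lambda>) = card (\<Lambda> + \<Lambda>)"
  proof (rule atMost_if_ceil_half_closed[OF assms])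
    fix a b assume "a \<in> \<Lambda>" "b \<in> \<Lambda>"
    \<comment> \<open>A subset of a finite set with the same cardinality is the whole set.\<close>
    then have "a + b \<in> ceil_half -` \<Lambda>"
      using card_subset_eq[OF fin sub that] by auto
    then show "ceil_half (a + b) \<in> \<Lambda>"
      by simp
  qed
  moreover have "card (ceil_half -` \<Lambda>) = card (\<Lambda> + \<Lambda>)" if "\<exists>k. \<Lambda> = {..k}"
    using that ceil_half_vimage_atMost by metis
  ultimately show ?thesis
    using card_mirror[OF assms(1)] card_ceil_half_vimage[OF assms(1)] card_mono[OF fin sub]
    by (metis (no_types, lifting))
qed

end
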